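(* Let $N=\{1,\ldots,n\}$ and let $C \subset \mathbb{R}^n$ be a compact convex set. The following statements are equivalent: (1) $C$ has a least weakly $(a,b)$-submajorized element for each $a \in \mathbb{R}^n_{>0}$ and $b \in \mathbb{R}^n$; (2) $C$ has a least weakly $(1,b)$-submajorized element for each $b \in \mathbb{R}^n$; (3) for each $b \in \mathbb{R}^n$, there exists $x^* \in C$ that is an optimal solution to $\min_{x \in C} \Phi(x+b)$ for any choice of non-decreasing continuous Schur-convex function $\Phi:\mathbb{R}^n\to\mathbb{R}$; (4) for each permutation $\pi$ of $N$, there exists $x^* \in C$ such that for all $x \in C$ we have $\sum_{i=1}^k x^*_{\pi(i)} \leq \sum_{i=1}^k x_{\pi(i)}$ for all $k \in N$; (5) the function $g(A) := \min_{x \in C} x(A)$, $A\subseteq N$, is supermodular and $B_{\text{sup}}(g) \subseteq C \subseteq P_{\text{sup}}(g)$.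
   Context: Notation: $x(A) := \sum_{i\in A} x_i$ for $x\in\mathbb{R}^n$, $A\subseteq N$; in "$(1,b)$", $1$ is the all-ones vector. Weak $(a,b)$-submajorization: for $a\in\mathbb{R}^n_{>0}$, $b\in\mathbb{R}^n$, $x$ is weakly $(a,b)$-submajorized by $y$ if $\sum_{i\in N} a_i\phi\left(\frac{x_i+b_i}{a_i}\right)\le \sum_{i\in N} a_i\phi\left(\frac{y_i+b_i}{a_i}\right)$ for all non-decreasing continuous convex functions $\phi:\mathbb{R}\to\mathbb{R}$. A vector $x\in C$ is a least weakly $(a,b)$-submajorized element of $C$ if $x$ is weakly $(a,b)$-submajorized by every $y\in C$. Schur-convexity: let $x^{\downarrow}$ denote the rearrangement of $x$ in non-increasing order; $x\prec y$ if $\sum_{i=1}^k x^{\downarrow}_i\le\sum_{i=1}^k y^{\downarrow}_i$ for all $k\in N$ and $x(N)=y(N)$. $\Phi:\mathbb{R}^n\to\mathbb{R}$ is Schur-convex if $x\prec y$ implies $\Phi(x)\le\Phi(y)$. $\Phi$ is non-decreasing if it is non-decreasing with respect to the componentwise order. Supermodularity: $g:2^N\to\mathbb{R}$ with $g(\emptyset)=0$ is supermodular if $g(A)+g(B)\le g(A\cup B)+g(A\cap B)$ for all $A,B\subseteq N$. $P_{\text{sup}}(g):=\{x\in\mathbb{R}^n : x(A)\ge g(A)\ \forall A\subseteq N\}$ and $B_{\text{sup}}(g):=\{x\in P_{\text{sup}}(g): x(N)=g(N)\}$. *)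

theory Defs
  imports "HOL-Analysis.Analysis" "HOL-Library.Multiset"
begin

text \<open>
  The ground set \<open>N = {1, \<dots>, n}\<close> is a finite index type \<open>'n\<close> with \<open>n = CARD('n)\<close>.
\<close>

definition coord_sum :: "real ^ 'n \<Rightarrow> 'n set \<Rightarrow> real" where
  "coord_sum x A = (\<Sum>i\<in>A. x $ i)"

definition weakly_submajorized ::
    "real ^ 'n::finite \<Rightarrow> real ^ 'n \<Rightarrow> real ^ 'n \<Rightarrow> real ^ 'n \<Rightarrow> bool" where
  "weakly_submajorized a b x y \<longleftrightarrow>
     (\<forall>\<phi>::real \<Rightarrow> real. mono \<phi> \<and> continuous_on UNIV \<phi> \<and> convex_on UNIV \<phi> \<longrightarrow>
        (\<Sum>i\<in>UNIV. a $ i * \<phi> ((x $ i + b $ i) / a $ i))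
          \<le> (\<Sum>i\<in>UNIV. a $ i * \<phi> ((y $ i + b $ i) / a $ i)))"

definition least_weakly_submajorized ::
    "real ^ 'n::finite \<Rightarrow> real ^ 'n \<Rightarrow> (real ^ 'n) set \<Rightarrow> real ^ 'n \<Rightarrow> bool" where
  "least_weakly_submajorized a b C x \<longleftrightarrow>
     x \<in> C \<and> (\<forall>y\<in>C. weakly_submajorized a b x y)"

text \<open>The entries of a vector, with multiplicity, in non-increasing order (indexed from 0).\<close>

definition decreasing_rearrangement :: "real ^ 'n::finite \<Rightarrow> real list" where
  "decreasing_rearrangement x =
     rev (sorted_list_of_multiset (image_mset (\<lambda>i. x $ i) (mset_set UNIV)))"

definition majorized :: "real ^ 'n::finite \<Rightarrow> real ^ 'n \<Rightarrow> bool" where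
  "majorized x y \<longleftrightarrow>
     (\<forall>k\<in>{1..CARD('n)}. (\<Sum>i<k. decreasing_rearrangement x ! i)
                          \<le> (\<Sum>i<k. decreasing_rearrangement y ! i)) \<and>
     coord_sum x UNIV = coord_sum y UNIV"

definition schur_convex :: "(real ^ 'n::finite \<Rightarrow> real) \<Rightarrow> bool" where
  "schur_convex \<Phi> \<longleftrightarrow> (\<forall>x y. majorized x y \<longrightarrow> \<Phi> x \<le> \<Phi> y)"

definition supermodular :: "('n set \<Rightarrow> real) \<Rightarrow> bool" where
  "supermodular g \<longleftrightarrow>
     g {} = 0 \<and> (\<forall>A B. g A + g B \<le> g (A \<union> B) + g (A \<inter> B))"

definition P_sup :: "('n set \<Rightarrow> real) \<Rightarrow> (real ^ 'n) set" where
  "P_sup g = {x. \<forall>A. coord_sum x A \<ge> g A}"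

definition B_sup :: "('n set \<Rightarrow> real) \<Rightarrow> (real ^ 'n) set" where
  "B_sup g = {x \<in> P_sup g. coord_sum x UNIV = g UNIV}"

text \<open>
  An infimum in the definition, which is a minimum for compact nonempty \<open>C\<close>, as the
  lemma below shows.
\<close>

definition min_coord_sum :: "(real ^ 'n) set \<Rightarrow> 'n set \<Rightarrow> real" where
  "min_coord_sum C A = (INF x\<in>C. coord_sum x A)"

lemma min_coord_sum_attained:
  fixes C :: "(real ^ 'n::finite) set"
  assumes "compact C" "C \<noteq> {}"
  shows "\<exists>x\<in>C. coord_sum x A = min_coord_sum C A \<and> (\<forall>y\<in>C. coord_sum x A \<le> coord_sum y A)"
proof -
  have "continuous_on C (\<lambda>x. coord_sum x A)"
    unfolding coord_sum_def by (intro continuous_intros)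
  then obtain x where x: "x \<in> C" "\<forall>y\<in>C. coord_sum x A \<le> coord_sum y A"
    using continuous_attains_inf assms by blast
  then have "min_coord_sum C A = coord_sum x A"
    unfolding min_coord_sum_def by (intro cInf_eq_minimum) auto
  with x show ?thesis by auto
qed

definition all_equivalent :: "bool list \<Rightarrow> bool" where
  "all_equivalent Ps \<longleftrightarrow> (\<forall>P\<in>set Ps. \<forall>Q\<in>set Ps. P \<longleftrightarrow> Q)"

end

theory Submission imports Defs
begin

text \<open>
  Majorization is tested on hinge functions: the sum of the \<open>k\<close> largest entries of \<open>x\<close> is the
  minimum over \<open>t\<close> of \<open>k t + \<Sum>\<^sub>i max 0 (x\<^sub>i - t)\<close>. If the entries of \<open>b\<close> are spread far apart
  in the order of a permutation, hinge sums of \<open>x + b\<close> are, up to constants, the prefix sums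
  of \<open>x\<close>, so (2) and (3) both give (4). The minimizers in (4) lie in \<open>C\<close> and are tight on all
  prefixes; this gives supermodularity of \<open>g\<close>, and a hyperplane separating \<open>C\<close> from a point of
  \<open>B_sup g\<close> is refuted by the minimizer of the order of its coefficients. Conversely, let \<open>x\<close>
  minimize \<open>\<Sum>\<^sub>i (x\<^sub>i + b\<^sub>i)\<^sup>2 / a\<^sub>i\<close> over \<open>B_sup g\<close>. All upper level sets of
  \<open>(x\<^sub>i + b\<^sub>i) / a\<^sub>i\<close> are tight, and summation by parts against a nonnegative nondecreasing
  subgradient gives (1). For (3), each element of \<open>C\<close> lies above some \<open>w \<in> B_sup g\<close>,
  and \<open>x + b\<close> is majorized by \<open>w + b\<close>.
\<close>

section \<open>Decreasing rearrangements and hinge sums\<close>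

lemma mset_decreasing_rearrangement:
  "mset (decreasing_rearrangement x) = image_mset (\<lambda>i. x $ i) (mset_set UNIV)"
  by (simp add: decreasing_rearrangement_def)

lemma length_decreasing_rearrangement:
  fixes x :: "real ^ 'n::finite"
  shows "length (decreasing_rearrangement x) = CARD('n)"
  using arg_cong[OF mset_decreasing_rearrangement[of x], of size] by simp

lemma decreasing_rearrangement_antimono:
  fixes x :: "real ^ 'n::finite"
  assumes "i \<le> j" "j < CARD('n)"
  shows "decreasing_rearrangement x ! j \<le> decreasing_rearrangement x ! i"
proof -
  have "sorted (rev (decreasing_rearrangement x))"
    by (simp add: decreasing_rearrangement_def)
  then show ?thesis
    using assms by (simp add: sorted_rev_iff_nth_mono length_decreasing_rearrangement)
qed

lemma sum_decreasing_rearrangement: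
  fixes x :: "real ^ 'n::finite" and f :: "real \<Rightarrow> real"
  shows "(\<Sum>i<CARD('n). f (decreasing_rearrangement x ! i)) = (\<Sum>i\<in>UNIV. f (x $ i))"
proof -
  have "(\<Sum>i<CARD('n). f (decreasing_rearrangement x ! i))
      = sum_list (map f (decreasing_rearrangement x))"
    by (simp add: sum_list_sum_nth length_decreasing_rearrangement atLeast0LessThan)
  also have "\<dots> = sum_mset (image_mset f (mset (decreasing_rearrangement x)))"
    by (metis mset_map sum_mset_sum_list)
  also have "\<dots> = (\<Sum>i\<in>UNIV. f (x $ i))"
    by (simp add: mset_decreasing_rearrangement sum_unfold_sum_mset multiset.map_comp comp_def)
  finally show ?thesis .
qed

definition hinge_sum :: "real \<Rightarrow> real ^ 'n::finite \<Rightarrow> real" where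
  "hinge_sum t x = (\<Sum>i\<in>UNIV. max 0 (x $ i - t))"

lemma continuous_on_hinge_sum: "continuous_on S (hinge_sum t)"
  unfolding hinge_sum_def by (intro continuous_intros)

lemma mono_hinge_sum: "mono (hinge_sum t)"
  unfolding mono_def hinge_sum_def
  by (auto intro!: sum_mono max.mono simp: less_eq_vec_def)

lemma sum_largest_le_hinge_sum:
  fixes x :: "real ^ 'n::finite"
  assumes "k \<le> CARD('n)"
  shows "(\<Sum>i<k. decreasing_rearrangement x ! i) \<le> real k * t + hinge_sum t x"
proof -
  let ?d = "\<lambda>i. decreasing_rearrangement x ! i"
  have "(\<Sum>i<k. ?d i) - real k * t = (\<Sum>i<k. ?d i - t)"
    by (simp add: sum_subtractf)
  also have "\<dots> \<le> (\<Sum>i<k. max 0 (?d i - t))"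
    by (intro sum_mono) auto
  also have "\<dots> \<le> (\<Sum>i<CARD('n). max 0 (?d i - t))"
    using assms by (intro sum_mono2) auto
  also have "\<dots> = hinge_sum t x"
    unfolding hinge_sum_def by (rule sum_decreasing_rearrangement)
  finally show ?thesis by simp
qed

lemma sum_largest_eq_hinge_sum:
  fixes x :: "real ^ 'n::finite"
  assumes "k \<le> CARD('n)"
    and "\<And>i. i < k \<Longrightarrow> t \<le> decreasing_rearrangement x ! i"
    and "\<And>i. k \<le> i \<Longrightarrow> i < CARD('n) \<Longrightarrow> decreasing_rearrangement x ! i \<le> t"
  shows "(\<Sum>i<k. decreasing_rearrangement x ! i) = real k * t + hinge_sum t x"
proof -
  let ?d = "\<lambda>i. decreasing_rearrangement x ! i"
  have "hinge_sum t x = (\<Sum>i<CARD('n). max 0 (?d i - t))"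
    unfolding hinge_sum_def by (rule sum_decreasing_rearrangement[symmetric])
  also have "\<dots> = (\<Sum>i<k. max 0 (?d i - t))"
    using assms by (intro sum.mono_neutral_right) (auto simp: not_less)
  also have "\<dots> = (\<Sum>i<k. ?d i - t)"
    using assms(2) by (intro sum.cong) auto
  finally show ?thesis by (simp add: sum_subtractf)
qed

lemma hinge_sum_attained:
  fixes x :: "real ^ 'n::finite"
  shows "\<exists>k\<le>CARD('n). (\<Sum>i<k. decreasing_rearrangement x ! i) = real k * t + hinge_sum t x"
proof -
  let ?d = "\<lambda>i. decreasing_rearrangement x ! i"
  \<comment> \<open>This is the number of entries exceeding \<open>t\<close>. The disjunct
    \<open>k = CARD('n)\<close> covers the case that all of them do, and keeps the list index in
    range.\<close>
  define k where "k = (LEAST k. k = CARD('n) \<or> ?d k \<le> t)"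
  have k: "k = CARD('n) \<or> ?d k \<le> t"
    unfolding k_def by (rule LeastI[where k = "CARD('n)"]) simp
  have kn: "k \<le> CARD('n)"
    unfolding k_def by (rule Least_le) simp
  have "t \<le> ?d i" if "i < k" for i
    using not_less_Least[of i "\<lambda>k. k = CARD('n) \<or> ?d k \<le> t"] that by (auto simp: k_def)
  moreover have "?d i \<le> t" if "k \<le> i" "i < CARD('n)" for i
    using k that decreasing_rearrangement_antimono[of k i x] by auto
  ultimately show ?thesis
    using sum_largest_eq_hinge_sum[of k t x] kn by blast
qed

text \<open>For each \<open>k\<close> one well-chosen threshold suffices: at the \<open>k\<close>-th
  largest entry of \<open>y\<close> the hinge bound on the sum of the \<open>k\<close> largest
  entries is an equality for \<open>y\<close>, and it is still an upper bound for
  \<open>x\<close>.\<close>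

lemma majorized_if_hinge_sum_le:
  fixes x y :: "real ^ 'n::finite"
  assumes hinge: "\<And>t. hinge_sum t x \<le> hinge_sum t y"
    and total: "coord_sum x UNIV = coord_sum y UNIV"
  shows "majorized x y"
  unfolding majorized_def
proof (intro conjI ballI total)
  fix k assume k: "k \<in> {1..CARD('n)}"
  define t where "t = decreasing_rearrangement y ! (k - 1)"
  have "(\<Sum>i<k. decreasing_rearrangement x ! i) \<le> real k * t + hinge_sum t x"
    using k by (intro sum_largest_le_hinge_sum) auto
  also have "\<dots> \<le> real k * t + hinge_sum t y"
    using hinge by simp
  also have "\<dots> = (\<Sum>i<k. decreasing_rearrangement y ! i)"
    using k unfolding t_def
    by (intro sum_largest_eq_hinge_sum[symmetric] decreasing_rearrangement_antimono) auto
  finally show "(\<Sum>i<k. decreasing_rearrangement x ! i) \<le> (\<Sum>i<k. decreasing_rearrangement y ! i)" .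
qed

text \<open>Dually, the hinge sum at \<open>t\<close> is the maximum over \<open>k\<close> of the
  sum of the \<open>k\<close> largest entries minus \<open>k t\<close>, and majorization can only
  increase each of these terms. The index \<open>k = 0\<close>, absent from
  \<open>majorized\<close>, is trivial.\<close>

lemma schur_convex_hinge_sum: "schur_convex (hinge_sum t :: real ^ 'n::finite \<Rightarrow> real)"
  unfolding schur_convex_def
proof (intro allI impI)
  fix x y :: "real ^ 'n"
  assume maj: "majorized x y"
  obtain k where k: "k \<le> CARD('n)"
      "(\<Sum>i<k. decreasing_rearrangement x ! i) = real k * t + hinge_sum t x"
    using hinge_sum_attained[of x t] by blast
  have "(\<Sum>i<k. decreasing_rearrangement x ! i) \<le> (\<Sum>i<k. decreasing_rearrangement y ! i)"
    using maj k(1) by (cases "k = 0") (auto simp: majorized_def)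
  with k sum_largest_le_hinge_sum[of k y t] show "hinge_sum t x \<le> hinge_sum t y"
    by auto
qed

lemma convex_on_hinge: "convex_on UNIV (\<lambda>s::real. max 0 (s - t))"
proof -
  have "max 0 (u * x + v * y - t) \<le> u * max 0 (x - t) + v * max 0 (y - t)"
    if "0 \<le> u" "0 \<le> v" "u + v = 1" for u v x y :: real
  proof -
    have "u * x + v * y - t = u * (x - t) + v * (y - t)"
      using that(3) by algebra
    moreover have "u * (x - t) \<le> u * max 0 (x - t)" "v * (y - t) \<le> v * max 0 (y - t)"
      using that by (auto intro: mult_left_mono)
    ultimately show ?thesis
      using that by auto
  qed
  then show ?thesis
    by (auto simp: convex_on_def)
qed

lemma weakly_submajorized_imp_hinge_sum_le:
  assumes "weakly_submajorized 1 b x y"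
  shows "hinge_sum t (x + b) \<le> hinge_sum t (y + b)"
proof -
  have "mono (\<lambda>s::real. max 0 (s - t))"
    by (auto simp: mono_def)
  moreover have "continuous_on UNIV (\<lambda>s::real. max 0 (s - t))"
    by (intro continuous_intros)
  ultimately show ?thesis
    using assms convex_on_hinge[of t] unfolding weakly_submajorized_def hinge_sum_def by fastforce
qed

section \<open>Sums over upper level sets\<close>

text \<open>Summation by parts: a nonnegative \<open>s\<close> is a nonnegative combination of
  indicators of its upper level sets. The induction splits off the minimum \<open>m\<close> of
  \<open>s\<close>, which contributes \<open>m\<close> times the full sum, and continues with
  \<open>s - m\<close> on the smaller set where it is positive.\<close>

lemma sum_weighted_nonneg_if_level_sums_nonneg:
  fixes s \<delta> :: "'a \<Rightarrow> real"
  assumes "finite S" "\<And>i. i \<in> S \<Longrightarrow> 0 \<le> s i"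
    and "\<And>r. 0 \<le> (\<Sum>i | i \<in> S \<and> r < s i. \<delta> i)"
  shows "0 \<le> (\<Sum>i\<in>S. s i * \<delta> i)"
  using assms
proof (induction "card S" arbitrary: S s rule: less_induct)
  case less
  show ?case
  proof (cases "S = {}")
    case False
    define m where "m = Min (s ` S)"
    define S' where "S' = {i \<in> S. m < s i}"
    have m: "m \<in> s ` S" "\<And>i. i \<in> S \<Longrightarrow> m \<le> s i"
      using less.prems(1) False by (auto simp: m_def)
    have "m \<ge> 0" using m less.prems(2) by auto
    have "S' \<subset> S" using m by (auto simp: S'_def)
    have "0 \<le> (\<Sum>i\<in>S'. (s i - m) * \<delta> i)"
    proof (rule less.hyps)
      show "card S' < card S" "finite S'"
        using \<open>S' \<subset> S\<close> less.prems(1) psubset_card_mono by (auto intro: finite_subset)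
      show "0 \<le> s i - m" if "i \<in> S'" for i
        using that by (auto simp: S'_def)
      show "0 \<le> (\<Sum>i | i \<in> S' \<and> r < s i - m. \<delta> i)" for r
      proof -
        \<comment> \<open>For negative \<open>r\<close> the left side is all of \<open>S'\<close>,
          the level set of \<open>s\<close> above \<open>m\<close>; hence the
          \<open>max 0 r\<close>.\<close>
        have "{i. i \<in> S' \<and> r < s i - m} = {i. i \<in> S \<and> m + max 0 r < s i}"
          by (auto simp: S'_def)
        then show ?thesis using less.prems(3) by metis
      qed
    qed
    also have "\<dots> = (\<Sum>i\<in>S. (s i - m) * \<delta> i)"
      using less.prems(1) m(2) by (intro sum.mono_neutral_left) (auto simp: S'_def not_less antisym)
    finally have 1: "0 \<le> (\<Sum>i\<in>S. (s i - m) * \<delta> i)" .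
    have "{i. i \<in> S \<and> -1 < s i} = S"
      using less.prems(2) by force
    then have "0 \<le> (\<Sum>i\<in>S. \<delta> i)"
      using less.prems(3)[of "-1"] by simp
    then have "0 \<le> m * (\<Sum>i\<in>S. \<delta> i)"
      using \<open>m \<ge> 0\<close> by simp
    then show ?thesis
      using 1 by (simp add: left_diff_distrib sum_subtractf sum_distrib_left)
  qed simp
qed

text \<open>Enumerate by decreasing \<open>f\<close>. Ties may be broken arbitrarily, since a level
  set contains either all or none of the indices with a common value. This links the prefix sums of
  (4) to sums over level sets.\<close>

lemma ex_enumeration_level_sets:
  fixes f :: "'n::finite \<Rightarrow> real"
  shows "\<exists>\<pi>. bij_betw \<pi> {1..CARD('n)} UNIV \<and> (\<forall>r. \<exists>k\<le>CARD('n). {j. r < f j} = \<pi> ` {1..k})"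
proof -
  obtain ys :: "'n list" where ys: "set ys = UNIV" "distinct ys"
    using finite_distinct_list[OF finite_class.finite_UNIV] by blast
  define xs where "xs = sort_key (\<lambda>i. - f i) ys"
  have xs: "set xs = UNIV" "distinct xs" "sorted (map (\<lambda>i. - f i) xs)"
    using ys by (auto simp: xs_def)
  have len: "length xs = CARD('n)"
    using distinct_card[OF xs(2)] xs(1) by simp
  define \<pi> where "\<pi> i = xs ! (i - 1)" for i
  have bij: "bij_betw \<pi> {1..CARD('n)} UNIV"
  proof -
    have "bij_betw (\<lambda>i. i - 1) {1..CARD('n)} {..<CARD('n)}"
      by (rule bij_betwI[where g = Suc]) auto
    moreover have "bij_betw ((!) xs) {..<CARD('n)} UNIV"
      using bij_betw_nth[OF xs(2)] len xs(1) by metis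
    ultimately have "bij_betw ((!) xs \<circ> (\<lambda>i. i - 1)) {1..CARD('n)} UNIV"
      by (rule bij_betw_trans)
    then show ?thesis
      by (simp add: \<pi>_def[abs_def] comp_def)
  qed
  have anti: "f (\<pi> j) \<le> f (\<pi> i)" if "1 \<le> i" "i \<le> j" "j \<le> CARD('n)" for i j
    using that sorted_nth_mono[OF xs(3), of "i - 1" "j - 1"] len by (auto simp: \<pi>_def)
  have "\<exists>k\<le>CARD('n). {j. r < f j} = \<pi> ` {1..k}" for r
  proof -
    define I where "I = {i \<in> {1..CARD('n)}. r < f (\<pi> i)}"
    have "{j. r < f j} = {j \<in> \<pi> ` {1..CARD('n)}. r < f j}"
      using bij by (simp add: bij_betw_def)
    also have "\<dots> = \<pi> ` I" unfolding I_def by blast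
    finally have level: "{j. r < f j} = \<pi> ` I" .
    show ?thesis
    proof (cases "I = {}")
      case True
      then show ?thesis using level by (intro exI[of _ 0]) auto
    next
      case False
      have "finite I" by (simp add: I_def)
      with False obtain m where m: "m \<in> I" "\<And>i. i \<in> I \<Longrightarrow> i \<le> m"
        using Max_in Max_ge by metis
      then have max: "m \<le> CARD('n)" "r < f (\<pi> m)"
        by (simp_all add: I_def)
      have "i \<in> I" if "1 \<le> i" "i \<le> m" for i
        using max anti[OF that max(1)] that by (simp add: I_def)
      moreover have "1 \<le> i" if "i \<in> I" for i
        using that by (simp add: I_def)
      ultimately have "I = {1..m}"
        using m(2) by (meson atLeastAtMost_iff set_eqI)
      then show ?thesis
        using level max(1) by metis
    qed
  qed
  then show ?thesis using bij by blast
qed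

section \<open>Tight sets\<close>

lemma coord_sum_add: "coord_sum (x + y) A = coord_sum x A + coord_sum y A"
  by (simp add: coord_sum_def sum.distrib)

lemma coord_sum_scaleR: "coord_sum (c *\<^sub>R x) A = c * coord_sum x A"
  by (simp add: coord_sum_def sum_distrib_left)

lemma coord_sum_minus: "coord_sum (- x) A = - coord_sum x A"
  by (simp add: coord_sum_def sum_negf)

lemma coord_sum_diff: "coord_sum (x - y) A = coord_sum x A - coord_sum y A"
  by (simp add: coord_sum_def sum_subtractf)

lemma coord_sum_axis: "coord_sum (axis i 1) A = (if i \<in> A then 1 else 0)"
  for A :: "'n::finite set"
  by (simp add: coord_sum_def axis_def if_distrib cong: if_cong)

lemma coord_sum_Un_Int:
  fixes A B :: "'n::finite set"
  shows "coord_sum x (A \<union> B) + coord_sum x (A \<inter> B) = coord_sum x A + coord_sum x B"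
  unfolding coord_sum_def by (rule sum.union_inter) auto

lemma continuous_on_coord_sum: "continuous_on S (\<lambda>x. coord_sum x A)"
  unfolding coord_sum_def by (intro continuous_intros)

lemma closed_P_sup: "closed (P_sup g)"
  unfolding P_sup_def
  by (intro closed_Collect_all closed_Collect_le continuous_on_coord_sum continuous_on_const)

text \<open>Uncrossing: coordinate sums are modular, so by supermodularity the nonnegative slacks at
  the union and the intersection have sum at most zero.\<close>

lemma tight_Un_Int:
  fixes x :: "real ^ 'n::finite"
  assumes "supermodular g" "x \<in> P_sup g" "coord_sum x A = g A" "coord_sum x B = g B"
  shows "coord_sum x (A \<union> B) = g (A \<union> B)" "coord_sum x (A \<inter> B) = g (A \<inter> B)"
proof -
  have "g A + g B \<le> g (A \<union> B) + g (A \<inter> B)"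
    using assms(1) by (simp add: supermodular_def)
  moreover have "g (A \<union> B) \<le> coord_sum x (A \<union> B)" "g (A \<inter> B) \<le> coord_sum x (A \<inter> B)"
    using assms(2) by (auto simp: P_sup_def)
  ultimately show "coord_sum x (A \<union> B) = g (A \<union> B)" "coord_sum x (A \<inter> B) = g (A \<inter> B)"
    using coord_sum_Un_Int[of x A B] assms(3,4) by linarith+
qed

text \<open>Tight sets are closed under union, and the empty set is tight because
  \<open>g {} = 0\<close>; so \<open>U\<close> is a finite union of tight sets.\<close>

lemma tight_if_covered:
  fixes x :: "real ^ 'n::finite"
  assumes "supermodular g" "x \<in> P_sup g"
    and cover: "\<And>i. i \<in> U \<Longrightarrow> \<exists>A\<subseteq>U. i \<in> A \<and> coord_sum x A = g A"
  shows "coord_sum x U = g U"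
proof -
  have "\<exists>A\<subseteq>U. F \<subseteq> A \<and> coord_sum x A = g A" if "finite F" "F \<subseteq> U" for F
    using that
  proof (induction F)
    case empty
    show ?case
      using assms(1) by (intro exI[of _ "{}"]) (auto simp: supermodular_def coord_sum_def)
  next
    case (insert i F)
    then obtain A B where "A \<subseteq> U" "F \<subseteq> A" "coord_sum x A = g A"
        "B \<subseteq> U" "i \<in> B" "coord_sum x B = g B"
      using cover by (meson insert_subset)
    then show ?case
      using tight_Un_Int(1)[OF assms(1,2), of A B] by (intro exI[of _ "A \<union> B"]) auto
  qed
  from this[of U] show ?thesis by auto
qed

text \<open>For fixed \<open>i\<close> in \<open>U\<close>, intersect the tight sets that exclude
  each \<open>j\<close> outside \<open>U\<close>, starting from \<open>UNIV\<close>, which is tight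
  on \<open>B_sup g\<close>. The result is a tight set inside \<open>U\<close> around
  \<open>i\<close>, and such sets cover \<open>U\<close>.\<close>

lemma tight_if_separated:
  fixes x :: "real ^ 'n::finite"
  assumes "supermodular g" "x \<in> B_sup g"
    and sep: "\<And>i j. i \<in> U \<Longrightarrow> j \<notin> U \<Longrightarrow> \<exists>A. i \<in> A \<and> j \<notin> A \<and> coord_sum x A = g A"
  shows "coord_sum x U = g U"
proof (rule tight_if_covered[OF assms(1)])
  show P: "x \<in> P_sup g" using assms(2) by (simp add: B_sup_def)
  fix i assume i: "i \<in> U"
  have "\<exists>A. i \<in> A \<and> A \<inter> F = {} \<and> coord_sum x A = g A" if "F \<subseteq> - U" for F
    using finite[of F] that
  proof (induction F rule: finite_induct)
    case empty
    have "coord_sum x UNIV = g UNIV"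
      using assms(2) by (simp add: B_sup_def)
    then show ?case by (intro exI[of _ UNIV]) simp
  next
    case (insert j F)
    then have "F \<subseteq> - U" "j \<notin> U" by simp_all
    obtain A where A: "i \<in> A" "A \<inter> F = {}" "coord_sum x A = g A"
      using insert.IH[OF \<open>F \<subseteq> - U\<close>] by (elim exE conjE)
    obtain B where B: "i \<in> B" "j \<notin> B" "coord_sum x B = g B"
      using sep[OF i \<open>j \<notin> U\<close>] by (elim exE conjE)
    show ?case
    proof (intro exI conjI)
      show "coord_sum x (A \<inter> B) = g (A \<inter> B)"
        by (rule tight_Un_Int(2)[OF assms(1) P A(3) B(3)])
    qed (use A B in auto)
  qed
  from this[OF order_refl] obtain A where "i \<in> A" "A \<inter> - U = {}" "coord_sum x A = g A"
    by (elim exE conjE)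
  then show "\<exists>A\<subseteq>U. i \<in> A \<and> coord_sum x A = g A"
    by (intro exI[of _ A]) auto
qed

text \<open>There are finitely many constraints: the slack ones survive a small step by continuity,
  and the tight ones do not get worse along \<open>d\<close>.\<close>

lemma eventually_P_sup_perturb:
  fixes x d :: "real ^ 'n::finite"
  assumes "x \<in> P_sup g" and dir: "\<And>A. coord_sum x A = g A \<Longrightarrow> 0 \<le> coord_sum d A"
  shows "\<forall>\<^sub>F e in at_right 0. x + e *\<^sub>R d \<in> P_sup g"
proof -
  have "\<forall>\<^sub>F e in at_right 0. g A \<le> coord_sum x A + e * coord_sum d A" for A
  proof (cases "coord_sum x A = g A")
    case True
    then show ?thesis
      using dir[OF True] by (auto simp: eventually_at_filter)
  next
    case False
    then have "g A < coord_sum x A"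
      using assms(1) by (auto simp: P_sup_def less_le)
    moreover have "((\<lambda>e. coord_sum x A + e * coord_sum d A) \<longlongrightarrow> coord_sum x A + 0 * coord_sum d A)
        (at_right 0)"
      by (intro tendsto_intros)
    ultimately have "\<forall>\<^sub>F e in at_right 0. g A < coord_sum x A + e * coord_sum d A"
      by (simp add: order_tendstoD)
    then show ?thesis by eventually_elim simp
  qed
  then have "\<forall>\<^sub>F e in at_right 0. \<forall>A. g A \<le> coord_sum x A + e * coord_sum d A"
    by (rule eventually_all_finite)
  then show ?thesis
    by (simp add: P_sup_def coord_sum_add coord_sum_scaleR)
qed

text \<open>Minimize the total over the part of \<open>P_sup g\<close> below \<open>x\<close>. At a
  minimum no coordinate can be lowered, so each one lies in a tight set, and the union of these
  makes \<open>UNIV\<close> tight. Singleton constraints bound the region from below.\<close>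

lemma ex_B_sup_below:
  fixes x :: "real ^ 'n::finite"
  assumes "supermodular g" "x \<in> P_sup g"
  shows "\<exists>w\<in>B_sup g. w \<le> x"
proof -
  define K where "K = P_sup g \<inter> {w. \<forall>i. w $ i \<le> x $ i}"
  have "closed K"
    unfolding K_def
    by (intro closed_Int closed_P_sup closed_Collect_all closed_Collect_le continuous_intros)
  moreover have "K \<subseteq> cbox (\<chi> i. g {i}) x"
  proof
    fix w assume w: "w \<in> K"
    have "g {i} \<le> coord_sum w {i}" for i
      using w by (auto simp: K_def P_sup_def)
    then show "w \<in> cbox (\<chi> i. g {i}) x"
      using w by (auto simp: K_def mem_box_cart coord_sum_def)
  qed
  ultimately have "compact K"
    using compact_Int_closed[OF compact_cbox, of K] by (metis Int_absorb1)
  moreover have "K \<noteq> {}"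
    using assms(2) by (auto simp: K_def)
  ultimately obtain w where w: "w \<in> K" "\<And>v. v \<in> K \<Longrightarrow> coord_sum w UNIV \<le> coord_sum v UNIV"
    using continuous_attains_inf[of K "\<lambda>w. coord_sum w UNIV"] continuous_on_coord_sum by blast
  have wP: "w \<in> P_sup g" using w(1) by (simp add: K_def)
  have "coord_sum w UNIV = g UNIV"
  proof (rule tight_if_covered[OF assms(1) wP])
    fix i :: 'n
    show "\<exists>A\<subseteq>UNIV. i \<in> A \<and> coord_sum w A = g A"
    proof (rule ccontr)
      assume "\<not> ?thesis"
      then have "\<forall>\<^sub>F e in at_right 0. w + e *\<^sub>R (- axis i 1) \<in> P_sup g"
        by (intro eventually_P_sup_perturb[OF wP]) (auto simp: coord_sum_axis coord_sum_minus)
      moreover have "\<forall>\<^sub>F e::real in at_right 0. 0 < e"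
        by (simp add: eventually_at_right_less)
      ultimately have "\<forall>\<^sub>F e::real in at_right 0. 0 < e \<and> w + e *\<^sub>R (- axis i 1) \<in> P_sup g"
        by eventually_elim simp
      then obtain e :: real where e: "0 < e" "w + e *\<^sub>R (- axis i 1) \<in> P_sup g"
        using eventually_happens'[OF trivial_limit_at_right_real] by blast
      have "(w + e *\<^sub>R (- axis i 1)) $ k \<le> w $ k" for k
        using e(1) by (simp add: axis_def)
      moreover have "w $ k \<le> x $ k" for k
        using w(1) by (simp add: K_def)
      ultimately have "w + e *\<^sub>R (- axis i 1) \<in> K"
        using e(2) unfolding K_def by (blast intro: order_trans)
      from w(2)[OF this] e(1) show False
        by (simp add: coord_sum_diff coord_sum_scaleR coord_sum_axis)
    qed
  qed
  then show ?thesis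
    using w(1) by (intro bexI[of _ w]) (auto simp: K_def B_sup_def less_eq_vec_def)
qed

section \<open>Least weakly submajorized elements from supermodularity\<close>

text \<open>First-order optimality: the partial derivatives of the quadratic \<open>q\<close> are
  twice these ratios, so whenever the ratio at \<open>j\<close> is below that at \<open>i\<close>, a
  tight set must block the exchange direction between the two.\<close>

lemma ex_B_sup_separating:
  fixes a b :: "real ^ 'n::finite"
  assumes "compact (B_sup g)" "B_sup g \<noteq> {}" and a: "\<And>i. 0 < a $ i"
  shows "\<exists>x\<in>B_sup g. \<forall>i j. (x $ j + b $ j) / a $ j < (x $ i + b $ i) / a $ i \<longrightarrow>
    (\<exists>A. i \<in> A \<and> j \<notin> A \<and> coord_sum x A = g A)"
proof -
  have a_nz: "a $ i \<noteq> 0" for i using a[of i] by simp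
  define q where "q x = (\<Sum>i\<in>UNIV. (x $ i + b $ i)\<^sup>2 / a $ i)" for x :: "real ^ 'n"
  have "continuous_on (B_sup g) q"
    unfolding q_def by (intro continuous_intros) (simp add: a_nz)
  then obtain x where x: "x \<in> B_sup g" and min: "\<And>y. y \<in> B_sup g \<Longrightarrow> q x \<le> q y"
    using continuous_attains_inf[OF assms(1,2)] by blast
  have xP: "x \<in> P_sup g" using x by (simp add: B_sup_def)
  have "\<exists>A. i \<in> A \<and> j \<notin> A \<and> coord_sum x A = g A"
    if less: "(x $ j + b $ j) / a $ j < (x $ i + b $ i) / a $ i" for i j
  proof (rule ccontr)
    assume no: "\<not> ?thesis"
    \<comment> \<open>moving mass from \<open>i\<close> to \<open>j\<close> would stay feasible and decrease \<open>q\<close>\<close>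
    define d where "d = axis j 1 - (axis i 1 :: real ^ 'n)"
    have ij: "i \<noteq> j" using less by auto
    \<comment> \<open>A set on which \<open>d\<close> has negative sum contains \<open>i\<close> and
      misses \<open>j\<close>; by \<open>no\<close> it is not tight.\<close>
    have P: "\<forall>\<^sub>F e in at_right 0. x + e *\<^sub>R d \<in> P_sup g"
      using no by (intro eventually_P_sup_perturb[OF xP]) (auto simp: d_def coord_sum_diff coord_sum_axis)
    \<comment> \<open>Half the slope and the quadratic coefficient of \<open>q\<close> along
      \<open>d\<close>.\<close>
    define p where "p = (x $ j + b $ j) / a $ j - (x $ i + b $ i) / a $ i"
    define c where "c = 1 / a $ i + 1 / a $ j"
    have q: "q (x + e *\<^sub>R d) = q x + e * (2 * p + e * c)" for e
    proof -
      have "q (x + e *\<^sub>R d) - q x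
          = (\<Sum>k\<in>UNIV. ((x $ k + e * d $ k + b $ k)\<^sup>2 - (x $ k + b $ k)\<^sup>2) / a $ k)"
        by (simp add: q_def sum_subtractf diff_divide_distrib)
      also have "\<dots> = (\<Sum>k\<in>{i,j}. ((x $ k + e * d $ k + b $ k)\<^sup>2 - (x $ k + b $ k)\<^sup>2) / a $ k)"
        by (intro sum.mono_neutral_right) (auto simp: d_def axis_def)
      also have "\<dots> = e * (2 * p + e * c)"
        using ij a[of i] a[of j]
        by (simp add: d_def axis_def p_def c_def divide_simps power2_eq_square) (simp add: algebra_simps)
      finally show ?thesis by simp
    qed
    have "((\<lambda>e. 2 * p + e * c) \<longlongrightarrow> 2 * p + 0 * c) (at_right 0)"
      by (intro tendsto_intros)
    moreover have "p < 0" using less by (simp add: p_def)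
    ultimately have neg: "\<forall>\<^sub>F e in at_right 0. 2 * p + e * c < 0"
      using order_tendstoD(2) by fastforce
    have pos: "\<forall>\<^sub>F e::real in at_right 0. 0 < e"
      by (simp add: eventually_at_right_less)
    have "\<forall>\<^sub>F e in at_right 0. 0 < e \<and> 2 * p + e * c < 0 \<and> x + e *\<^sub>R d \<in> P_sup g"
      using P neg pos by eventually_elim simp
    then obtain e where e: "0 < e" "2 * p + e * c < 0" "x + e *\<^sub>R d \<in> P_sup g"
      using eventually_happens'[OF trivial_limit_at_right_real] by blast
    then have "x + e *\<^sub>R d \<in> B_sup g"
      using x by (simp add: B_sup_def coord_sum_add coord_sum_scaleR d_def coord_sum_diff coord_sum_axis)
    from min[OF this] have "0 \<le> e * (2 * p + e * c)" by (simp add: q)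
    then show False using e mult_pos_neg[of e "2 * p + e * c"] by linarith
  qed
  then show ?thesis using x by blast
qed

text \<open>The separating \<open>x\<close> is chosen before \<open>\<phi>\<close>, so it serves all
  test functions at once. Monotonicity of \<open>\<phi>\<close> makes the subgradient weights
  nonnegative, which allows comparison with all of \<open>P_sup g\<close> and not only with points
  of equal total.\<close>

lemma ex_B_sup_weakly_submajorized:
  fixes a b :: "real ^ 'n::finite"
  assumes "supermodular g" "compact (B_sup g)" "B_sup g \<noteq> {}" and a: "\<And>i. 0 < a $ i"
  shows "\<exists>x\<in>B_sup g. \<forall>y\<in>P_sup g. weakly_submajorized a b x y"
proof -
  obtain x where x: "x \<in> B_sup g"
    and sep: "\<And>i j. (x $ j + b $ j) / a $ j < (x $ i + b $ i) / a $ i \<Longrightarrow>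
      \<exists>A. i \<in> A \<and> j \<notin> A \<and> coord_sum x A = g A"
    using ex_B_sup_separating[OF assms(2,3) a, of b] by metis
  have "weakly_submajorized a b x y" if y: "y \<in> P_sup g" for y
    unfolding weakly_submajorized_def
  proof (intro allI impI, elim conjE)
    fix \<phi> :: "real \<Rightarrow> real"
    assume \<phi>: "mono \<phi>" "convex_on UNIV \<phi>"
    define z w where "z i = (x $ i + b $ i) / a $ i" and "w i = (y $ i + b $ i) / a $ i" for i
    \<comment> \<open>The right derivative of \<open>\<phi>\<close>, as the infimum of the
      difference quotients to the right.\<close>
    define s where "s u = Inf ((\<lambda>t. (\<phi> u - \<phi> t) / (u - t)) ` ({u<..} \<inter> UNIV))" for u
    have s: "\<phi> u + s u * (v - u) \<le> \<phi> v" for u v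
      unfolding s_def by (rule convex_le_Inf_differential[OF \<phi>(2)]) auto
    have s_nonneg: "0 \<le> s u" for u
      using s[of u "u - 1"] monoD[OF \<phi>(1), of "u - 1" u] by simp
    \<comment> \<open>Adding the subgradient inequalities at \<open>u\<close> and \<open>v\<close>
      gives monotonicity. In this form it turns a strict inequality of weights into one of ratios,
      as \<open>sep\<close> requires.\<close>
    have s_mono: "u < v" if "s u < s v" for u v
    proof (rule ccontr)
      assume "\<not> u < v"
      have "(s v - s u) * (u - v) \<le> 0"
        using s[of u v] s[of v u] by (simp add: algebra_simps)
      with that \<open>\<not> u < v\<close> have "u = v"
        by (auto simp: mult_le_0_iff)
      with that show False by simp
    qed
    have "0 \<le> (\<Sum>i\<in>UNIV. s (z i) * (y $ i - x $ i))"
    proof (rule sum_weighted_nonneg_if_level_sums_nonneg)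
      fix r
      let ?U = "{i. i \<in> UNIV \<and> r < s (z i)}"
      have "coord_sum x ?U = g ?U"
      proof (rule tight_if_separated[OF assms(1) x])
        fix i j assume "i \<in> ?U" "j \<notin> ?U"
        then have "s (z j) < s (z i)" by simp
        from s_mono[OF this] show "\<exists>A. i \<in> A \<and> j \<notin> A \<and> coord_sum x A = g A"
          by (intro sep) (simp add: z_def)
      qed
      moreover have "g ?U \<le> coord_sum y ?U"
        using y by (auto simp: P_sup_def)
      ultimately show "0 \<le> (\<Sum>i\<in>?U. y $ i - x $ i)"
        by (simp add: coord_sum_def sum_subtractf)
    qed (auto simp: s_nonneg)
    also have "\<dots> = (\<Sum>i\<in>UNIV. a $ i * (s (z i) * (w i - z i)))"
    proof (intro sum.cong refl)
      fix i
      have "a $ i * (w i - z i) = y $ i - x $ i"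
        using a[of i] by (simp add: z_def w_def right_diff_distrib)
      then show "s (z i) * (y $ i - x $ i) = a $ i * (s (z i) * (w i - z i))"
        by (simp add: mult.left_commute)
    qed
    also have "\<dots> \<le> (\<Sum>i\<in>UNIV. a $ i * (\<phi> (w i) - \<phi> (z i)))"
    proof (intro sum_mono mult_left_mono)
      show "s (z i) * (w i - z i) \<le> \<phi> (w i) - \<phi> (z i)" for i
        using s[of "z i" "w i"] by linarith
      show "0 \<le> a $ i" for i using a[of i] by simp
    qed
    finally show "(\<Sum>i\<in>UNIV. a $ i * \<phi> ((x $ i + b $ i) / a $ i))
        \<le> (\<Sum>i\<in>UNIV. a $ i * \<phi> ((y $ i + b $ i) / a $ i))"
      by (simp add: z_def w_def right_diff_distrib sum_subtractf)
  qed
  then show ?thesis using x by blast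
qed

section \<open>Compact convex sets\<close>

lemma min_coord_sum_le:
  fixes C :: "(real ^ 'n::finite) set"
  assumes "compact C" "x \<in> C"
  shows "min_coord_sum C A \<le> coord_sum x A"
  using min_coord_sum_attained[OF assms(1), of A] assms(2) by (metis empty_iff)

lemma min_coord_sum_empty:
  assumes "C \<noteq> {}"
  shows "min_coord_sum C {} = 0"
  using assms by (simp add: min_coord_sum_def coord_sum_def)

text \<open>For empty \<open>C\<close> the infimum is one fixed value for all \<open>A\<close>, and
  \<open>g {} = 0\<close> forces it to be 0; then the origin lies in \<open>B_sup\<close>. So (5)
  excludes the empty set, as the existence claims in the other statements do.\<close>

lemma nonempty_if_B_sup_subset:
  fixes C :: "(real ^ 'n::finite) set"
  assumes "supermodular (min_coord_sum C)" "B_sup (min_coord_sum C) \<subseteq> C"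
  shows "C \<noteq> {}"
proof
  assume "C = {}"
  then have "min_coord_sum C A = min_coord_sum C {}" for A
    by (simp add: min_coord_sum_def)
  then have "min_coord_sum C A = 0" for A
    using assms(1) by (simp add: supermodular_def)
  then have "0 \<in> B_sup (min_coord_sum C)"
    by (simp add: B_sup_def P_sup_def coord_sum_def)
  with assms(2) \<open>C = {}\<close> show False by auto
qed

lemma B_sup_compact_nonempty:
  fixes C :: "(real ^ 'n::finite) set"
  assumes "compact C" "supermodular (min_coord_sum C)"
    "B_sup (min_coord_sum C) \<subseteq> C" "C \<subseteq> P_sup (min_coord_sum C)"
  shows "compact (B_sup (min_coord_sum C))" "B_sup (min_coord_sum C) \<noteq> {}"
proof -
  let ?g = "min_coord_sum C"
  have "closed (B_sup ?g)"
    unfolding B_sup_def Collect_conj_eq Collect_mem_eq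
    by (intro closed_Int closed_P_sup closed_Collect_eq continuous_on_coord_sum continuous_on_const)
  then show "compact (B_sup ?g)"
    using compact_Int_closed[OF assms(1)] assms(3) by (metis Int_absorb1)
  show "B_sup ?g \<noteq> {}"
    using min_coord_sum_attained[OF assms(1) nonempty_if_B_sup_subset[OF assms(2,3)], of UNIV] assms(4)
    by (auto simp: B_sup_def)
qed

section \<open>From hinge sums to prefix sums: (2) and (3) imply (4)\<close>

lemma prefix_minimizer_if_hinge_minimizer:
  fixes C :: "(real ^ 'n::finite) set"
  assumes "bounded C"
    and hinge: "\<And>b. \<exists>x\<in>C. \<forall>y\<in>C. \<forall>t. hinge_sum t (x + b) \<le> hinge_sum t (y + b)"
    and \<pi>: "bij_betw \<pi> {1..CARD('n)} (UNIV :: 'n set)"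
  shows "\<exists>xs\<in>C. \<forall>x\<in>C. \<forall>k\<in>{1..CARD('n)}. (\<Sum>i=1..k. xs $ \<pi> i) \<le> (\<Sum>i=1..k. x $ \<pi> i)"
proof -
  obtain M where M: "\<And>x. x \<in> C \<Longrightarrow> norm x \<le> M" "M > 0"
    using assms(1) by (auto simp: bounded_pos)
  have coord: "\<bar>x $ j\<bar> \<le> M" if "x \<in> C" for x j
    using M(1)[OF that] component_le_norm_cart[of x j] by linarith
  \<comment> \<open>Coordinates of points of \<open>C\<close> lie in \<open>[-M, M]\<close>, so
    entry \<open>\<pi> i\<close> of \<open>x + b\<close> is within \<open>M\<close> of
    \<open>-4 M i\<close>. The shift \<open>b\<close> thus forces the order of the entries, and the
    threshold \<open>-4 M k - 2 M\<close> lies midway between the centres for \<open>k\<close> and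
    \<open>k + 1\<close>.\<close>
  define b :: "real ^ 'n" where
    "b = (\<chi> j. - 4 * M * real (the_inv_into {1..CARD('n)} \<pi> j))"
  have b: "b $ \<pi> i = - 4 * M * real i" if "i \<in> {1..CARD('n)}" for i
    using that \<pi> by (simp add: b_def bij_betw_def the_inv_into_f_f)
  have eval: "hinge_sum (- 4 * M * real k - 2 * M) (x + b)
      = (\<Sum>i=1..k. x $ \<pi> i) + (\<Sum>i=1..k. b $ \<pi> i + 4 * M * real k + 2 * M)"
    if "x \<in> C" "k \<in> {1..CARD('n)}" for x k
  proof -
    let ?t = "- 4 * M * real k - 2 * M"
    have "hinge_sum ?t (x + b) = (\<Sum>i=1..CARD('n). max 0 ((x + b) $ \<pi> i - ?t))"
      unfolding hinge_sum_def by (rule sum.reindex_bij_betw[OF \<pi>, symmetric])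
    also have "\<dots> = (\<Sum>i=1..k. max 0 ((x + b) $ \<pi> i - ?t))"
    proof (intro sum.mono_neutral_right ballI)
      fix i assume i: "i \<in> {1..CARD('n)} - {1..k}"
      then have "M * (real k + 1) \<le> M * real i"
        using M(2) by (intro mult_left_mono) auto
      moreover have "x $ \<pi> i \<le> M" using coord[OF that(1), of "\<pi> i"] by linarith
      ultimately show "max 0 ((x + b) $ \<pi> i - ?t) = 0"
        using i M(2) b[of i] by (simp add: algebra_simps)
    qed (use that in auto)
    also have "\<dots> = (\<Sum>i=1..k. x $ \<pi> i + (b $ \<pi> i + 4 * M * real k + 2 * M))"
    proof (intro sum.cong refl)
      fix i assume i: "i \<in> {1..k}"
      then have "M * real i \<le> M * real k"
        using M(2) by (intro mult_left_mono) auto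
      moreover have "- M \<le> x $ \<pi> i" using coord[OF that(1), of "\<pi> i"] by linarith
      moreover have "(x + b) $ \<pi> i - ?t = x $ \<pi> i - 4 * (M * real i) + 4 * (M * real k) + 2 * M"
        using i that(2) b[of i] by simp
      ultimately have "0 \<le> (x + b) $ \<pi> i - ?t"
        using M(2) by linarith
      then show "max 0 ((x + b) $ \<pi> i - ?t) = x $ \<pi> i + (b $ \<pi> i + 4 * M * real k + 2 * M)"
        by simp
    qed
    finally show ?thesis by (simp add: sum.distrib)
  qed
  \<comment> \<open>The second summand in \<open>eval\<close> is the same for all points of
    \<open>C\<close>, and one \<open>xs\<close> handles all thresholds, hence all
    \<open>k\<close>.\<close>
  obtain xs where xs: "xs \<in> C" "\<And>y t. y \<in> C \<Longrightarrow> hinge_sum t (xs + b) \<le> hinge_sum t (y + b)"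
    using hinge[of b] by blast
  have "(\<Sum>i=1..k. xs $ \<pi> i) \<le> (\<Sum>i=1..k. x $ \<pi> i)" if "x \<in> C" "k \<in> {1..CARD('n)}" for x k
    using xs(2)[OF that(1), of "- 4 * M * real k - 2 * M"] eval[OF that] eval[OF xs(1) that(2)]
    by linarith
  then show ?thesis using xs(1) by blast
qed

section \<open>From prefix minimizers to supermodularity: (4) implies (5)\<close>

lemma ex_tight_on_level_sets:
  fixes C :: "(real ^ 'n::finite) set" and f :: "'n \<Rightarrow> real"
  assumes "compact C" and prefix: "\<And>\<pi>. bij_betw \<pi> {1..CARD('n)} (UNIV :: 'n set) \<Longrightarrow>
      \<exists>xs\<in>C. \<forall>x\<in>C. \<forall>k\<in>{1..CARD('n)}. (\<Sum>i=1..k. xs $ \<pi> i) \<le> (\<Sum>i=1..k. x $ \<pi> i)"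
  shows "\<exists>x\<in>C. \<forall>r. coord_sum x {j. r < f j} = min_coord_sum C {j. r < f j}"
proof -
  \<comment> \<open>In an order of decreasing \<open>f\<close> all level sets are prefixes, so one
    prefix minimizer is tight on all of them simultaneously.\<close>
  obtain \<pi> where \<pi>: "bij_betw \<pi> {1..CARD('n)} UNIV"
    and level: "\<And>r. \<exists>k\<le>CARD('n). {j. r < f j} = \<pi> ` {1..k}"
    using ex_enumeration_level_sets[of f] by blast
  obtain xs where xs: "xs \<in> C" "\<And>x k. x \<in> C \<Longrightarrow> k \<in> {1..CARD('n)} \<Longrightarrow>
      (\<Sum>i=1..k. xs $ \<pi> i) \<le> (\<Sum>i=1..k. x $ \<pi> i)"
    using prefix[OF \<pi>] by blast
  have "coord_sum xs {j. r < f j} = min_coord_sum C {j. r < f j}" for r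
  proof -
    obtain k where k: "k \<le> CARD('n)" "{j. r < f j} = \<pi> ` {1..k}"
      using level by blast
    have "inj_on \<pi> {1..k}"
      using \<pi> k(1) by (auto simp: bij_betw_def intro: inj_on_subset)
    then have sum: "coord_sum x {j. r < f j} = (\<Sum>i=1..k. x $ \<pi> i)" for x
      by (simp add: k(2) coord_sum_def sum.reindex comp_def)
    obtain x where x: "x \<in> C" "coord_sum x {j. r < f j} = min_coord_sum C {j. r < f j}"
      using min_coord_sum_attained[OF assms(1)] xs(1) by blast
    have "coord_sum xs {j. r < f j} \<le> coord_sum x {j. r < f j}"
      unfolding sum using xs(2)[OF x(1), of k] k(1) by (cases "k = 0") auto
    then show ?thesis
      using x(2) min_coord_sum_le[OF assms(1) xs(1), of "{j. r < f j}"] by simp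
  qed
  then show ?thesis using xs(1) by blast
qed

text \<open>It is enough to have one point of \<open>C\<close> tight on both the union and the
  intersection. These belong to a chain, and a chain consists of level sets of a single function,
  here the sum of the indicators.\<close>

lemma supermodular_min_coord_sum_if_tight:
  fixes C :: "(real ^ 'n::finite) set"
  assumes "compact C" and tight: "\<And>f :: 'n \<Rightarrow> real.
      \<exists>x\<in>C. \<forall>r. coord_sum x {j. r < f j} = min_coord_sum C {j. r < f j}"
  shows "supermodular (min_coord_sum C)"
  unfolding supermodular_def
proof (intro conjI allI)
  show "min_coord_sum C {} = 0"
    using tight by (intro min_coord_sum_empty) blast
  fix A B :: "'n set"
  define f :: "'n \<Rightarrow> real" where
    "f = (\<lambda>j. indicator (A \<inter> B) j + indicator A j + indicator (A \<union> B) j)"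
  have level: "{j. 0 < f j} = A \<union> B" "{j. 1 < f j} = A" "{j. 2 < f j} = A \<inter> B"
    by (auto simp: f_def indicator_def split: if_splits)
  obtain x where x: "x \<in> C" "\<And>r. coord_sum x {j. r < f j} = min_coord_sum C {j. r < f j}"
    using tight by blast
  have "min_coord_sum C A + min_coord_sum C B \<le> coord_sum x A + coord_sum x B"
    using min_coord_sum_le[OF assms(1) x(1)] by (intro add_mono)
  also have "\<dots> = coord_sum x (A \<union> B) + coord_sum x (A \<inter> B)"
    by (rule coord_sum_Un_Int[symmetric])
  also have "\<dots> = min_coord_sum C (A \<union> B) + min_coord_sum C (A \<inter> B)"
    using x(2)[of 0] x(2)[of 2] level by simp
  finally show "min_coord_sum C A + min_coord_sum C B
      \<le> min_coord_sum C (A \<union> B) + min_coord_sum C (A \<inter> B)" .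
qed

text \<open>If \<open>c\<close> separated \<open>y\<close> from \<open>C\<close>, the point of
  \<open>C\<close> tight on the level sets of \<open>c\<close> would, by summation by parts, have an
  inner product with \<open>c\<close> no larger than that of \<open>y\<close>.\<close>

lemma B_sup_min_coord_sum_subset_if_tight:
  fixes C :: "(real ^ 'n::finite) set"
  assumes "compact C" "convex C" and tight: "\<And>f :: 'n \<Rightarrow> real.
      \<exists>x\<in>C. \<forall>r. coord_sum x {j. r < f j} = min_coord_sum C {j. r < f j}"
  shows "B_sup (min_coord_sum C) \<subseteq> C"
proof (rule ccontr)
  assume "\<not> ?thesis"
  then obtain y where y: "y \<in> B_sup (min_coord_sum C)" "y \<notin> C" by blast
  obtain c \<beta> where sep: "c \<bullet> y < \<beta>" "\<And>x. x \<in> C \<Longrightarrow> \<beta> < c \<bullet> x"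
    using separating_hyperplane_closed_point[OF assms(2) compact_imp_closed[OF assms(1)] y(2)] by blast
  obtain x where x: "x \<in> C"
    "\<And>r. coord_sum x {j. r < c $ j} = min_coord_sum C {j. r < c $ j}"
    using tight[of "\<lambda>j. c $ j"] by blast
  \<comment> \<open>The coefficients may be negative. Subtracting their minimum makes the weights
    nonnegative and leaves the comparison unchanged, since \<open>x\<close> and \<open>y\<close>
    have the same total.\<close>
  define m where "m = Min (range (\<lambda>j. c $ j))"
  have m: "m \<le> c $ j" for j by (simp add: m_def)
  have "{j. m - 1 < c $ j} = UNIV"
    using less_le_trans[OF _ m, of "m - 1"] by simp
  then have total: "coord_sum x UNIV = coord_sum y UNIV"
    using x(2)[of "m - 1"] y(1) by (simp add: B_sup_def)
  have "0 \<le> (\<Sum>j\<in>UNIV. (c $ j - m) * (y $ j - x $ j))"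
  proof (rule sum_weighted_nonneg_if_level_sums_nonneg)
    fix r
    have "{j. j \<in> UNIV \<and> r < c $ j - m} = {j. r + m < c $ j}" by (auto simp: algebra_simps)
    moreover have "coord_sum x {j. r + m < c $ j} \<le> coord_sum y {j. r + m < c $ j}"
      using y(1) by (simp add: x(2) B_sup_def P_sup_def)
    ultimately show "0 \<le> (\<Sum>j | j \<in> UNIV \<and> r < c $ j - m. y $ j - x $ j)"
      by (simp add: coord_sum_def sum_subtractf)
  qed (auto simp: m)
  also have "\<dots> = c \<bullet> y - c \<bullet> x - m * (coord_sum y UNIV - coord_sum x UNIV)"
    by (simp add: inner_vec_def coord_sum_def sum_subtractf algebra_simps sum.distrib sum_distrib_left)
  finally show False
    using sep(1) sep(2)[OF x(1)] total by simp
qed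

section \<open>The equivalence of the five statements\<close>

lemma all_equivalentI:
  assumes "P1 \<Longrightarrow> P2" "P2 \<Longrightarrow> P4" "P3 \<Longrightarrow> P4" "P4 \<Longrightarrow> P5" "P5 \<Longrightarrow> P1" "P5 \<Longrightarrow> P3"
  shows "all_equivalent [P1, P2, P3, P4, P5]"
  unfolding all_equivalent_def using assms by auto

theorem theorem3:
  fixes C :: "(real ^ 'n::finite) set"
  assumes "compact C" and "convex C"
  shows "all_equivalent
    [\<forall>a b. (\<forall>i. a $ i > 0) \<longrightarrow> (\<exists>x. least_weakly_submajorized a b C x),
     \<forall>b. \<exists>x. least_weakly_submajorized 1 b C x,
     \<forall>b. \<exists>xs\<in>C. \<forall>\<Phi>. mono \<Phi> \<and> continuous_on UNIV \<Phi> \<and> schur_convex \<Phi> \<longrightarrow>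
        (\<forall>x\<in>C. \<Phi> (xs + b) \<le> \<Phi> (x + b)),
     \<forall>\<pi>. bij_betw \<pi> {1..CARD('n)} (UNIV :: 'n set) \<longrightarrow>
        (\<exists>xs\<in>C. \<forall>x\<in>C. \<forall>k\<in>{1..CARD('n)}. (\<Sum>i=1..k. xs $ \<pi> i) \<le> (\<Sum>i=1..k. x $ \<pi> i)),
     supermodular (min_coord_sum C) \<and>
       B_sup (min_coord_sum C) \<subseteq> C \<and> C \<subseteq> P_sup (min_coord_sum C)]"
    (is "all_equivalent [?ab, ?ones, ?schur, ?prefix, ?super]")
proof -
  let ?g = "min_coord_sum C"
  have ab_ones: ?ones if ?ab
  proof
    show "\<exists>x. least_weakly_submajorized 1 b C x" for b
      by (rule \<open>?ab\<close>[rule_format]) simp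
  qed
  have ones_prefix: ?prefix if ?ones
  proof (intro allI impI prefix_minimizer_if_hinge_minimizer compact_imp_bounded assms(1))
    fix b
    obtain x where "least_weakly_submajorized 1 b C x" using \<open>?ones\<close> by blast
    then show "\<exists>x\<in>C. \<forall>y\<in>C. \<forall>t. hinge_sum t (x + b) \<le> hinge_sum t (y + b)"
      unfolding least_weakly_submajorized_def
      by (blast intro: weakly_submajorized_imp_hinge_sum_le)
  qed
  have schur_prefix: ?prefix if ?schur
  proof (intro allI impI prefix_minimizer_if_hinge_minimizer compact_imp_bounded assms(1))
    fix b
    obtain x where "x \<in> C" "\<forall>\<Phi>. mono \<Phi> \<and> continuous_on UNIV \<Phi> \<and> schur_convex \<Phi> \<longrightarrow>
        (\<forall>y\<in>C. \<Phi> (x + b) \<le> \<Phi> (y + b))"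
      using \<open>?schur\<close> by blast
    then show "\<exists>x\<in>C. \<forall>y\<in>C. \<forall>t. hinge_sum t (x + b) \<le> hinge_sum t (y + b)"
      by (intro bexI[of _ x] ballI allI)
        (simp_all add: mono_hinge_sum continuous_on_hinge_sum schur_convex_hinge_sum)
  qed
  have prefix_super: ?super if ?prefix
  proof (intro conjI)
    have tight: "\<exists>x\<in>C. \<forall>r. coord_sum x {j. r < f j} = ?g {j. r < f j}" for f :: "'n \<Rightarrow> real"
      using ex_tight_on_level_sets[OF assms(1)] \<open>?prefix\<close> by blast
    show "supermodular ?g"
      using supermodular_min_coord_sum_if_tight[OF assms(1) tight] .
    show "B_sup ?g \<subseteq> C"
      using B_sup_min_coord_sum_subset_if_tight[OF assms tight] .
    show "C \<subseteq> P_sup ?g"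
      using min_coord_sum_le[OF assms(1)] by (auto simp: P_sup_def)
  qed
  have least: "\<exists>x\<in>B_sup ?g. \<forall>y\<in>P_sup ?g. weakly_submajorized a b x y"
    if ?super "\<forall>i. 0 < a $ i" for a b
  proof (rule ex_B_sup_weakly_submajorized)
    show "supermodular ?g" "0 < a $ i" for i using that by blast+
    show "compact (B_sup ?g)" "B_sup ?g \<noteq> {}"
      using B_sup_compact_nonempty[OF assms(1)] \<open>?super\<close> by blast+
  qed
  have super_ab: ?ab if ?super
  proof (intro allI impI)
    fix a b :: "real ^ 'n" assume "\<forall>i. a $ i > 0"
    from least[OF \<open>?super\<close> this, of b] obtain x
      where "x \<in> B_sup ?g" "\<forall>y\<in>P_sup ?g. weakly_submajorized a b x y" by blast
    then have "least_weakly_submajorized a b C x"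
      using \<open>?super\<close> unfolding least_weakly_submajorized_def by blast
    then show "\<exists>x. least_weakly_submajorized a b C x" ..
  qed
  have super_schur: ?schur if ?super
  proof
    fix b
    obtain xs where xs: "xs \<in> B_sup ?g" "\<And>y. y \<in> P_sup ?g \<Longrightarrow> weakly_submajorized 1 b xs y"
    proof -
      have "\<forall>i. 0 < (1 :: real ^ 'n) $ i" by simp
      from least[OF \<open>?super\<close> this, of b] show thesis using that by blast
    qed
    have "\<Phi> (xs + b) \<le> \<Phi> (x + b)" if \<Phi>: "mono \<Phi>" "schur_convex \<Phi>" and x: "x \<in> C"
      for \<Phi> :: "real ^ 'n \<Rightarrow> real" and x
    proof -
      \<comment> \<open>Majorization demands equal totals, which \<open>xs\<close> and
        \<open>x\<close> need not have. The detour through \<open>w\<close> restores this, and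
        monotonicity of \<open>\<Phi>\<close> covers the passage from \<open>w\<close> to
        \<open>x\<close>.\<close>
      obtain w where w: "w \<in> B_sup ?g" "w \<le> x"
      proof -
        have "supermodular ?g" "x \<in> P_sup ?g" using \<open>?super\<close> x by blast+
        from ex_B_sup_below[OF this] show thesis using that by blast
      qed
      have "majorized (xs + b) (w + b)"
      proof (rule majorized_if_hinge_sum_le)
        show "hinge_sum t (xs + b) \<le> hinge_sum t (w + b)" for t
          using w xs(2) by (intro weakly_submajorized_imp_hinge_sum_le) (simp add: B_sup_def)
        show "coord_sum (xs + b) UNIV = coord_sum (w + b) UNIV"
          using w xs(1) by (simp add: coord_sum_add B_sup_def)
      qed
      then have "\<Phi> (xs + b) \<le> \<Phi> (w + b)"
        using \<Phi>(2) by (simp add: schur_convex_def)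
      also have "\<dots> \<le> \<Phi> (x + b)"
        using w(2) by (intro monoD[OF \<Phi>(1)]) (simp add: less_eq_vec_def)
      finally show ?thesis .
    qed
    then show "\<exists>xs\<in>C. \<forall>\<Phi>. mono \<Phi> \<and> continuous_on UNIV \<Phi> \<and> schur_convex \<Phi> \<longrightarrow>
        (\<forall>x\<in>C. \<Phi> (xs + b) \<le> \<Phi> (x + b))"
    proof (intro bexI[of _ xs] allI impI ballI)
      show "xs \<in> C" using xs(1) \<open>?super\<close> by blast
    qed blast
  qed
  show ?thesis
    by (rule all_equivalentI[OF ab_ones ones_prefix schur_prefix prefix_super super_ab super_schur])
qed

end
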